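(* Let $r,s$ be positive integers, and let $n:=r+s$. Let $$\Phi_s(z) := \sum_{i = 0}^s (-1)^{s - i} z^{\underline{s - i}}\, p_{s, i} \in \mathbb{Q}[z],\qquad p_{s, i} := \frac{\binom{s}{i}}{2^i}\, \frac{ (r + i - 1)^{\underline{\lfloor i / 2 \rfloor}}\, (r + 1)^{\overline{i}} }{ (r + 1 / 2)^{\overline{\lfloor i / 2 \rfloor}} }.$$ Assume that there exists a tight symmetric inner distribution code for the Johnson scheme $J(2n,n)$ of degree $s$. Then the polynomial $\Phi_s(z)$ has distinct integral zeros (i.e. its zeros are $s$ distinct integers). Moreover, the zeros are in the interval $[1,r+s-1]$.
   Context: Falling and rising factorials: $x^{\underline{k}}=x(x-1)\cdots(x-k+1)$ and $x^{\overline{k}}=x(x+1)\cdots(x+k-1)$, with $x^{\underline{0}}=x^{\overline{0}}=1$. The Johnson scheme $J(2n,n)$ has point set $\binom{[2n]}{n}$, the $n$-element subsets of $[2n]=\{1,\ldots,2n\}$, with distance $d_J(x,y)=n-|x\cap y|$. For a code $C\subseteq\binom{[2n]}{n}$, the degree set is $S(C)=\{d_J(x,y):x,y\in C,\ x\ne y\}$ and the degree is $|S(C)|$. The code $C$ is a symmetric inner distribution code if $a\in S(C)$ implies $n-a\in S(C)$. A symmetric inner distribution code $C$ of degree $s$ in $J(2n,n)$ is tight if $|C|=\binom{2n-1}{s}$. *)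

theory Defs
  imports Complex_Main "HOL-Computational_Algebra.Computational_Algebra"
begin

text \<open>The rising factorial is the library function \<^const>\<open>pochhammer\<close>.\<close>

definition falling_fact :: "'a::comm_ring_1 \<Rightarrow> nat \<Rightarrow> 'a" where
  "falling_fact x k = (\<Prod>j<k. x - of_nat j)"

definition johnson_points :: "nat \<Rightarrow> nat set set" where
  "johnson_points n = {x. x \<subseteq> {1..2 * n} \<and> card x = n}"

text \<open>Only applied to points of \<open>J(2n,n)\<close>, where the subtraction does not truncate.\<close>

definition johnson_dist :: "nat \<Rightarrow> nat set \<Rightarrow> nat set \<Rightarrow> nat" where
  "johnson_dist n x y = n - card (x \<inter> y)"

definition degree_set :: "nat \<Rightarrow> nat set set \<Rightarrow> nat set" where
  "degree_set n C = {johnson_dist n x y | x y. x \<in> C \<and> y \<in> C \<and> x \<noteq> y}"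

definition code_degree :: "nat \<Rightarrow> nat set set \<Rightarrow> nat" where
  "code_degree n C = card (degree_set n C)"

definition symmetric_code :: "nat \<Rightarrow> nat set set \<Rightarrow> bool" where
  "symmetric_code n C \<longleftrightarrow>
     C \<subseteq> johnson_points n \<and> (\<forall>a. a \<in> degree_set n C \<longrightarrow> n - a \<in> degree_set n C)"

definition tight_symmetric_code :: "nat \<Rightarrow> nat \<Rightarrow> nat set set \<Rightarrow> bool" where
  "tight_symmetric_code n s C \<longleftrightarrow>
     symmetric_code n C \<and> code_degree n C = s \<and> card C = (2 * n - 1) choose s"

definition Phi_coeff :: "nat \<Rightarrow> nat \<Rightarrow> nat \<Rightarrow> rat" where
  "Phi_coeff r s i =
     of_nat (s choose i) / 2 ^ i *
     (falling_fact (of_nat r + of_nat i - 1) (i div 2) * pochhammer (of_nat r + 1) i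
       / pochhammer (of_nat r + 1 / 2) (i div 2))"

text \<open>The polynomial \<open>[:0, 1:]\<close> is the indeterminate \<open>z\<close>.\<close>

definition Phi :: "nat \<Rightarrow> nat \<Rightarrow> rat poly" where
  "Phi r s = (\<Sum>i\<le>s. (-1) ^ (s - i) * falling_fact [:0, 1:] (s - i) * [:Phi_coeff r s i:])"

end

theory Submission
  imports Defs "HOL-Library.Function_Algebras"
begin

text \<open>
  The zeros of \<open>\<Phi>\<^sub>s\<close> are the \<open>s\<close> distances of the code. In other words, \<open>\<Phi>\<^sub>s\<close> is a
  multiple of the annihilator \<open>f(z) = (\<Prod>a\<in>S(C). z - a)\<close>. This is a theorem of Lloyd type, but it
  is proved here without the spectral theory of the Johnson scheme.

  Folding. The degree set is invariant under \<open>a \<mapsto> n - a\<close> and does not contain \<open>0\<close>, so it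
  does not contain \<open>n\<close> either. Replacing every point of \<open>C\<close> that contains \<open>2n\<close> by its complement thus
  gives a code of the same size whose distances lie in \<open>S(C)\<close>, now in the slice
  of \<open>n\<close>-subsets of \<open>{1..2n-1}\<close> (\<open>folded_symmetric_code\<close>). For a code with \<open>s\<close> distances in this
  slice, \<open>2n - 1 choose s\<close> is the largest possible size.

  Extremality. On the slice, all functions \<open>x \<mapsto> g (d(x, y))\<close> with \<open>g\<close> of degree at most \<open>s\<close> lie in
  the span of the \<open>2n - 1 choose s\<close> indicator functions of \<open>T \<subseteq> x\<close>, \<open>card T = s\<close>
  (\<open>dist_fun_in_span_inclusion_funs\<close>). The functions \<open>f (d(\<cdot>, c))\<close>, \<open>c\<close> in the code, are linearly
  independent because they are diagonal on the code, so by the size of the code they form a basis.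
  Expanding \<open>g (d(\<cdot>, y))\<close> in this basis and summing over \<open>y\<close> shows that
  \<open>\<Sum>d. (n choose d) * (n - 1 choose d) * g d * f d\<close> is a constant multiple of \<open>g 0\<close>
  (\<open>reproducing_of_extremal_code\<close>).

  Uniqueness. The weights are positive on more than \<open>s\<close> points, so this property
  determines a polynomial of degree at most \<open>s\<close> up to a factor (\<open>reproducing_unique\<close>).

  Computation. \<open>\<Phi>\<^sub>s\<close> has the property as well (\<open>Phi_reproducing\<close>). The coefficients \<open>p\<^sub>s\<^sub>,\<^sub>i\<close> contain the
  quotient of the rising factorials \<open>r(r+1)\<cdots>(r+i-1)\<close> and \<open>2r(2r+1)\<cdots>(2r+i-1)\<close> once the floors
  are removed (\<open>Phi_coeff_eq\<close>). Testing against falling factorials of \<open>n - 1 - z\<close> and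
  summing over \<open>d\<close> by Vandermonde leaves the \<open>s\<close>-th finite difference of a monic polynomial of
  degree \<open>s\<close> in \<open>i\<close> (\<open>beta_moment_term\<close>), which is \<open>s!\<close> for every test polynomial.
\<close>

lemma sum_fun_apply: "sum f I x = (\<Sum>i\<in>I. f i x)"
  for f :: "'i \<Rightarrow> 'a \<Rightarrow> 'b::comm_monoid_add"
  by (induction I rule: infinite_finite_induct) auto

section \<open>Interpolation by a diagonal family\<close>

interpretation fun_space: vector_space "\<lambda>c (f :: 'a \<Rightarrow> rat) x. c * f x"
  by unfold_locales (auto simp: fun_eq_iff algebra_simps)

text \<open>The \<open>F c\<close> are linearly independent, because evaluation at \<open>c\<close> kills all of them
  except \<open>F c\<close>. As many independent vectors as a spanning set has elements form a basis, and then
  evaluation at the points of \<open>D\<close> reads off the coordinates of \<open>h\<close>.\<close>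

lemma interpolation_from_diagonal_family:
  fixes F :: "'i \<Rightarrow> 'i \<Rightarrow> rat" and B :: "('i \<Rightarrow> rat) set"
  assumes "finite B" "card B \<le> card D"
    and F_span: "\<And>c. c \<in> D \<Longrightarrow> F c \<in> fun_space.span B"
    and F_diag: "\<And>c. c \<in> D \<Longrightarrow> F c c \<noteq> 0"
    and F_off: "\<And>c c'. c \<in> D \<Longrightarrow> c' \<in> D \<Longrightarrow> c \<noteq> c' \<Longrightarrow> F c c' = 0"
    and "finite D" and h_span: "h \<in> fun_space.span B"
  shows "h x = (\<Sum>c\<in>D. h c / F c c * F c x)"
proof -
  have vanish: "v c = 0" if "c \<in> D" "v \<in> fun_space.span (F ` D - {F c})" for v c
    using that(2)
  proof (induction rule: fun_space.span_induct_alt)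
    case (step a w y)
    then obtain d where "d \<in> D" "w = F d" "d \<noteq> c" by auto
    then show ?case using step that(1) F_off by auto
  qed auto
  have inj: "inj_on F D"
    by (rule inj_onI) (metis F_diag F_off)
  have indep: "fun_space.independent (F ` D)"
    unfolding fun_space.dependent_def using vanish F_diag by blast
  have "h \<in> fun_space.span (F ` D)"
  proof (rule ccontr)
    assume h: "h \<notin> fun_space.span (F ` D)"
    have ind: "fun_space.independent (insert h (F ` D))"
      using h indep by (rule fun_space.independent_insertI)
    have sub: "insert h (F ` D) \<subseteq> fun_space.span B"
      using F_span h_span by auto
    have "card (insert h (F ` D)) \<le> card B"
      using fun_space.independent_span_bound[OF assms(1) ind sub] by simp
    moreover have "h \<notin> F ` D" using h fun_space.span_base by blast
    ultimately show False using assms(2,6) inj by (simp add: card_image)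
  qed
  then have "\<forall>x. h x = (\<Sum>c\<in>D. h c / F c c * F c x)"
  proof (induction rule: fun_space.span_induct_alt)
    case base
    show ?case by simp
  next
    case (step a w y)
    then obtain d where d: "d \<in> D" "w = F d" by auto
    show ?case
    proof
      fix x
      have "(\<Sum>c\<in>D. F d c / F c c * F c x) = (\<Sum>c\<in>D. if c = d then F d x else 0)"
        using d F_diag F_off by (intro sum.cong) auto
      also have "\<dots> = F d x" using d \<open>finite D\<close> by simp
      finally have "(\<Sum>c\<in>D. F d c / F c c * F c x) = F d x" .
      moreover have "(\<Sum>c\<in>D. ((\<lambda>x. a * w x) + y) c / F c c * F c x)
          = a * (\<Sum>c\<in>D. F d c / F c c * F c x) + (\<Sum>c\<in>D. y c / F c c * F c x)"
        by (simp add: d sum_distrib_left sum.distrib add_divide_distrib algebra_simps)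
      moreover have "y x = (\<Sum>c\<in>D. y c / F c c * F c x)" using step.IH by blast
      ultimately show "((\<lambda>x. a * w x) + y) x
          = (\<Sum>c\<in>D. ((\<lambda>x. a * w x) + y) c / F c c * F c x)"
        using d(2) by simp
    qed
  qed
  then show ?thesis by blast
qed

section \<open>Polynomials of bounded degree\<close>

text \<open>One polynomial of each degree \<open>0, \<dots>, s\<close> spans the polynomials of degree at most \<open>s\<close>, so a
  linear property of all of these need only be checked on a convenient basis. Falling factorials
  of \<open>m - z\<close> are the convenient basis below.\<close>

lemma poly_induct_graded_basis [consumes 1, case_names basis add smult]:
  fixes B :: "nat \<Rightarrow> 'a::field poly"
  assumes "degree p \<le> s"
    and basis: "\<And>j. j \<le> s \<Longrightarrow> degree (B j) = j \<and> B j \<noteq> 0 \<and> P (B j)"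
    and add: "\<And>p q. P p \<Longrightarrow> P q \<Longrightarrow> P (p + q)"
    and smult: "\<And>c p. P p \<Longrightarrow> P (smult c p)"
  shows "P p"
  using assms(1,2)
proof (induction s arbitrary: p)
  case 0
  from 0(2)[of 0] obtain b where b: "B 0 = [:b:]" "b \<noteq> 0" 
    by (metis degree_eq_zeroE le_refl pCons_0_0)
  from 0(1) obtain a where a: "p = [:a:]" by (metis degree_eq_zeroE le_zero_eq)
  have "p = smult (a / b) (B 0)" using a b by simp
  then show ?case using 0(2)[of 0] smult by auto
next
  case (Suc s)
  define c where "c = coeff p (Suc s) / lead_coeff (B (Suc s))"
  define q where "q = p - smult c (B (Suc s))"
  have B: "degree (B (Suc s)) = Suc s" "B (Suc s) \<noteq> 0" "P (B (Suc s))" using Suc.prems(2) by auto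
  have "coeff q i = 0" if "i > s" for i
  proof (cases "i = Suc s")
    case True
    have "coeff (B (Suc s)) (Suc s) \<noteq> 0" using B by (metis leading_coeff_0_iff)
    then show ?thesis using B True by (simp add: q_def c_def)
  next
    case False
    then have "i > degree p" "i > degree (B (Suc s))" using that Suc.prems B by auto
    then show ?thesis by (simp add: q_def coeff_eq_0)
  qed
  then have "degree q \<le> s" by (intro degree_le) auto
  then have "P q" using Suc by auto
  then have "P (q + smult c (B (Suc s)))" using add smult B by blast
  then show ?case by (simp add: q_def)
qed

lemma degree_falling_fact_linear:
  fixes a b :: "'a::idom"
  assumes "b \<noteq> 0"
  shows "degree (falling_fact [:a, b:] k) = k \<and> falling_fact [:a, b:] k \<noteq> 0"
proof (induction k)
  case (Suc k)
  have "falling_fact [:a, b:] (Suc k) = falling_fact [:a, b:] k * [:a - of_nat k, b:]"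
    by (simp add: falling_fact_def of_nat_poly)
  moreover have "[:a - of_nat k, b:] \<noteq> 0" "degree [:a - of_nat k, b:] = 1" using assms by auto
  ultimately show ?case using Suc by (metis Suc_eq_plus1 degree_mult_eq no_zero_divisors)
qed (simp add: falling_fact_def)

lemma poly_falling_fact: "poly (falling_fact p k) x = falling_fact (poly p x) k"
  by (simp add: falling_fact_def poly_prod)

lemma falling_fact_of_nat: "falling_fact (of_nat w) t = (fact t * of_nat (w choose t) :: rat)"
  by (simp add: falling_fact_def binomial_gbinomial gbinomial_prod_rev atLeast0LessThan)

section \<open>Inclusion functions\<close>

text \<open>Both sides count the pairs \<open>U \<subseteq> T\<close> with \<open>card U = t\<close>, \<open>card T = s\<close>,
  \<open>T \<subseteq> x\<close> and \<open>U \<subseteq> y\<close>: on the left \<open>T\<close> is chosen first, on the right \<open>U\<close>.\<close>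

lemma card_subset_pairs:
  assumes "finite A" "y \<subseteq> A" "x \<subseteq> A" "t \<le> s"
  shows "(\<Sum>T | T \<subseteq> A \<and> card T = s \<and> T \<subseteq> x. card (T \<inter> y) choose t)
       = (card (x \<inter> y) choose t) * ((card x - t) choose (s - t))"
proof -
  have finx: "finite x" using finite_subset[OF assms(3,1)] .
  let ?T = "{T. T \<subseteq> A \<and> card T = s \<and> T \<subseteq> x}" and ?U = "{U. U \<subseteq> x \<inter> y \<and> card U = t}"
  have finT: "finite ?T" using assms(1) by simp
  have finU: "finite ?U" using finx by simp
  have "(\<Sum>T\<in>?T. card (T \<inter> y) choose t) = (\<Sum>T\<in>?T. \<Sum>U\<in>?U. if U \<subseteq> T then 1 else 0)"
  proof (rule sum.cong)
    fix T assume T: "T \<in> ?T"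
    then have "finite (T \<inter> y)" using finx by (auto intro: finite_subset)
    then have "card (T \<inter> y) choose t = card {U. U \<subseteq> T \<inter> y \<and> card U = t}"
      by (simp only: n_subsets)
    also have "{U. U \<subseteq> T \<inter> y \<and> card U = t} = {U\<in>?U. U \<subseteq> T}" using T by auto
    also have "card \<dots> = (\<Sum>U\<in>?U. if U \<subseteq> T then 1 else 0)"
      using finU by (simp add: sum.If_cases Int_def)
    finally show "card (T \<inter> y) choose t = (\<Sum>U\<in>?U. if U \<subseteq> T then 1 else 0)" .
  qed simp
  also have "\<dots> = (\<Sum>U\<in>?U. \<Sum>T\<in>?T. if U \<subseteq> T then 1 else 0)" by (rule sum.swap)
  also have "\<dots> = (\<Sum>U\<in>?U. (card x - t) choose (s - t))"
  proof (rule sum.cong)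
    fix U assume U: "U \<in> ?U"
    then have fU: "finite U" "U \<subseteq> x" "card U = t" using finx by (auto intro: finite_subset)
    have "(\<Sum>T\<in>?T. if U \<subseteq> T then 1 else 0) = card {T\<in>?T. U \<subseteq> T}"
      using finT by (simp add: sum.If_cases Int_def)
    also have "\<dots> = card {V. V \<subseteq> x - U \<and> card V = s - t}"
    proof (rule bij_betw_same_card[of "\<lambda>T. T - U"], rule bij_betw_byWitness[where f' = "\<lambda>V. V \<union> U"])
      show "(\<lambda>T. T - U) ` {T\<in>?T. U \<subseteq> T} \<subseteq> {V. V \<subseteq> x - U \<and> card V = s - t}"
        using fU by (auto simp: card_Diff_subset)
      show "(\<lambda>V. V \<union> U) ` {V. V \<subseteq> x - U \<and> card V = s - t} \<subseteq> {T\<in>?T. U \<subseteq> T}"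
      proof
        fix W assume "W \<in> (\<lambda>V. V \<union> U) ` {V. V \<subseteq> x - U \<and> card V = s - t}"
        then obtain V where V: "W = V \<union> U" "V \<subseteq> x - U" "card V = s - t" by auto
        then have "finite V" "V \<inter> U = {}" using finx by (auto intro: finite_subset)
        then have "card W = s" using V fU assms by (simp add: card_Un_disjoint)
        then show "W \<in> {T\<in>?T. U \<subseteq> T}" using V fU assms by auto
      qed
    qed auto
    also have "\<dots> = (card x - t) choose (s - t)"
      using n_subsets[of "x - U" "s - t"] finx fU by (simp add: card_Diff_subset)
    finally show "(\<Sum>T\<in>?T. if U \<subseteq> T then 1 else 0) = (card x - t) choose (s - t)" .
  qed simp
  also have "\<dots> = (card (x \<inter> y) choose t) * ((card x - t) choose (s - t))"
    using n_subsets[of "x \<inter> y" t] finx by simp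
  finally show ?thesis .
qed

definition slice :: "'a set \<Rightarrow> nat \<Rightarrow> 'a set set" where
  "slice A k = {x. x \<subseteq> A \<and> card x = k}"

text \<open>Both kinds of functions are cut off to \<open>0\<close> outside the slice, so that an identity between
  functions on the slice is an identity between total functions.\<close>

definition inclusion_fun :: "'a set \<Rightarrow> nat \<Rightarrow> 'a set \<Rightarrow> 'a set \<Rightarrow> rat" where
  "inclusion_fun A k T x = (if x \<in> slice A k \<and> T \<subseteq> x then 1 else 0)"

definition dist_fun :: "nat set \<Rightarrow> nat \<Rightarrow> rat poly \<Rightarrow> nat set \<Rightarrow> nat set \<Rightarrow> rat" where
  "dist_fun A k p y x = (if x \<in> slice A k then poly p (of_nat (johnson_dist k x y)) else 0)"

lemma finite_slice: "finite A \<Longrightarrow> finite (slice A k)"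
  by (rule finite_subset[of _ "Pow A"]) (auto simp: slice_def)

lemma card_slice: "finite A \<Longrightarrow> card (slice A k) = card A choose k"
  by (simp add: slice_def n_subsets)

lemma of_nat_johnson_dist:
  assumes "finite x" "card x = k"
  shows "of_nat (johnson_dist k x y) = (of_nat k - of_nat (card (x \<inter> y)) :: rat)"
proof -
  have "card (x \<inter> y) \<le> k" using assms card_mono[of x "x \<inter> y"] by auto
  then show ?thesis by (simp add: johnson_dist_def of_nat_diff)
qed

text \<open>This is where the upper bound \<open>card A choose s\<close> for a code of degree \<open>s\<close> comes from. In
  terms of \<open>w = card (x \<inter> y)\<close> the distance is \<open>k - w\<close>, and the falling factorials of \<open>w\<close>
  are multiples of binomial coefficients \<open>w choose t\<close>. These count the \<open>t\<close>-subsets of \<open>y\<close> that lie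
  in \<open>x\<close>, and on a slice the inclusion function of a \<open>t\<close>-set with \<open>t \<le> s\<close> is proportional to the
  sum of the inclusion functions of the \<open>s\<close>-sets that contain it.\<close>

lemma dist_fun_in_span_inclusion_funs:
  assumes "finite A" "y \<in> slice A k" "s \<le> k" "degree p \<le> s"
  shows "dist_fun A k p y \<in> fun_space.span (inclusion_fun A k ` slice A s)"
  using assms(4)
proof (induction rule: poly_induct_graded_basis[where B = "falling_fact [:of_nat k, -1:]"])
  case (basis t)
  let ?W = "fun_space.span (inclusion_fun A k ` slice A s)"
  define c :: rat where "c = fact t / of_nat ((k - t) choose (s - t))"
  have pos: "of_nat ((k - t) choose (s - t)) \<noteq> (0 :: rat)"
    using basis assms(3) by simp
  have eq: "dist_fun A k (falling_fact [:of_nat k, -1:] t) y x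
      = (\<Sum>T\<in>slice A s. c * of_nat (card (T \<inter> y) choose t) * inclusion_fun A k T x)" for x
  proof (cases "x \<in> slice A k")
    case True
    then have x: "finite x" "card x = k" "x \<subseteq> A"
      using assms(1) by (auto simp: slice_def intro: finite_subset)
    have "dist_fun A k (falling_fact [:of_nat k, -1:] t) y x
        = fact t * of_nat (card (x \<inter> y) choose t)"
      using True x by (simp add: dist_fun_def poly_falling_fact of_nat_johnson_dist falling_fact_of_nat)
    also have "\<dots> = c * of_nat ((card (x \<inter> y) choose t) * ((card x - t) choose (s - t)))"
      using pos x by (simp add: c_def)
    also have "(card (x \<inter> y) choose t) * ((card x - t) choose (s - t))
        = (\<Sum>T | T \<subseteq> A \<and> card T = s \<and> T \<subseteq> x. card (T \<inter> y) choose t)"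
      using assms x basis by (intro card_subset_pairs[symmetric]) (auto simp: slice_def)
    also have "c * of_nat \<dots>
        = (\<Sum>T | T \<subseteq> A \<and> card T = s \<and> T \<subseteq> x. c * of_nat (card (T \<inter> y) choose t))"
      by (simp add: sum_distrib_left)
    also have "\<dots> = (\<Sum>T\<in>slice A s. c * of_nat (card (T \<inter> y) choose t) * inclusion_fun A k T x)"
      using True finite_slice[OF assms(1)]
      by (intro sum.mono_neutral_cong_left) (auto simp: slice_def inclusion_fun_def)
    finally show ?thesis .
  qed (simp add: dist_fun_def inclusion_fun_def)
  have "(\<Sum>T\<in>slice A s. (\<lambda>x. c * of_nat (card (T \<inter> y) choose t) * inclusion_fun A k T x)) \<in> ?W"
    by (intro fun_space.span_sum fun_space.span_scale fun_space.span_base) auto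
  also have "(\<Sum>T\<in>slice A s. (\<lambda>x. c * of_nat (card (T \<inter> y) choose t) * inclusion_fun A k T x))
      = dist_fun A k (falling_fact [:of_nat k, -1:] t) y"
    by (simp add: fun_eq_iff sum_fun_apply eq)
  finally show ?case
    using degree_falling_fact_linear[of "-1 :: rat" "of_nat k" t] by simp
next
  case (add p q)
  have "dist_fun A k (p + q) y = dist_fun A k p y + dist_fun A k q y"
    by (auto simp: dist_fun_def)
  then show ?case using add fun_space.span_add by metis
next
  case (smult c p)
  have "dist_fun A k (smult c p) y = (\<lambda>x. c * dist_fun A k p y x)"
    by (auto simp: dist_fun_def)
  then show ?case using smult fun_space.span_scale by metis
qed

section \<open>Counting distances in a slice\<close>

text \<open>A point \<open>y\<close> at distance \<open>d\<close> from \<open>c\<close> arises by choosing the \<open>k - d\<close> elements of \<open>c\<close> that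
  it keeps and the \<open>d\<close> elements outside \<open>c\<close> that it adds.\<close>

lemma card_sphere:
  assumes "finite A" "c \<in> slice A k"
  shows "card {y \<in> slice A k. johnson_dist k c y = d} = (if d \<le> k then (k choose d) * ((card A - k) choose d) else 0)"
proof (cases "d \<le> k")
  case True
  have c: "finite c" "card c = k" "c \<subseteq> A"
    using assms by (auto simp: slice_def intro: finite_subset)
  let ?L = "{u. u \<subseteq> c \<and> card u = k - d} \<times> {w. w \<subseteq> A - c \<and> card w = d}"
  have "bij_betw (\<lambda>y. (c \<inter> y, y - c)) {y \<in> slice A k. johnson_dist k c y = d} ?L"
  proof (rule bij_betw_byWitness[where f' = "\<lambda>(u, w). u \<union> w"])
    show "(\<lambda>y. (c \<inter> y, y - c)) ` {y \<in> slice A k. johnson_dist k c y = d} \<subseteq> ?L"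
    proof
      fix p assume "p \<in> (\<lambda>y. (c \<inter> y, y - c)) ` {y \<in> slice A k. johnson_dist k c y = d}"
      then obtain y where y: "y \<subseteq> A" "card y = k" "k - card (c \<inter> y) = d" and p: "p = (c \<inter> y, y - c)"
        by (auto simp: slice_def johnson_dist_def)
      have fy: "finite y" using y(1) assms(1) by (rule finite_subset)
      have le: "card (c \<inter> y) \<le> k" using fy y(2) card_mono[of y "c \<inter> y"] by simp
      have "card y = card (c \<inter> y) + card (y - c)"
        using fy by (metis Int_commute card_Int_Diff)
      then show "p \<in> ?L" using y le True p by auto
    qed
    show "(\<lambda>(u, w). u \<union> w) ` ?L \<subseteq> {y \<in> slice A k. johnson_dist k c y = d}"
    proof
      fix y assume "y \<in> (\<lambda>(u, w). u \<union> w) ` ?L"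
      then obtain u w where uw: "y = u \<union> w" "u \<subseteq> c" "card u = k - d" "w \<subseteq> A - c" "card w = d"
        by auto
      have f: "finite u" "finite w" using uw c assms(1) by (auto intro: finite_subset)
      have "u \<inter> w = {}" "c \<inter> y = u" using uw by auto
      then show "y \<in> {y \<in> slice A k. johnson_dist k c y = d}"
        using uw f c True by (auto simp: slice_def johnson_dist_def card_Un_disjoint)
    qed
  qed auto
  then have "card {y \<in> slice A k. johnson_dist k c y = d} = card ?L" by (rule bij_betw_same_card)
  also have "\<dots> = (k choose (k - d)) * ((card A - k) choose d)"
    using c assms(1) by (simp add: card_cartesian_product n_subsets card_Diff_subset)
  finally show ?thesis using True by (simp add: binomial_symmetric[of d k])
next
  case False
  then have "{y \<in> slice A k. johnson_dist k c y = d} = {}" by (auto simp: johnson_dist_def)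
  then have "card {y \<in> slice A k. johnson_dist k c y = d} = 0" by (simp only: card.empty)
  then show ?thesis using False by simp
qed

definition sphere_weight :: "nat \<Rightarrow> nat \<Rightarrow> nat \<Rightarrow> rat" where
  "sphere_weight k m d = of_nat ((k choose d) * (m choose d))"

lemma sum_over_slice_by_distance:
  fixes F :: "nat \<Rightarrow> rat"
  assumes "finite A" "c \<in> slice A k"
  shows "(\<Sum>y\<in>slice A k. F (johnson_dist k c y)) = (\<Sum>d\<le>card A - k. sphere_weight k (card A - k) d * F d)"
proof -
  have "(\<Sum>y\<in>slice A k. F (johnson_dist k c y))
      = (\<Sum>d\<le>k. \<Sum>y\<in>{y \<in> slice A k. johnson_dist k c y = d}. F (johnson_dist k c y))"
    using finite_slice[OF assms(1)] by (intro sum.group[symmetric]) (auto simp: johnson_dist_def)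
  also have "\<dots> = (\<Sum>d\<le>k. sphere_weight k (card A - k) d * F d)"
    using assms by (intro sum.cong) (simp_all add: card_sphere sphere_weight_def)
  also have "\<dots> = (\<Sum>d\<le>max k (card A - k). sphere_weight k (card A - k) d * F d)"
    by (intro sum.mono_neutral_left) (auto simp: sphere_weight_def)
  also have "\<dots> = (\<Sum>d\<le>card A - k. sphere_weight k (card A - k) d * F d)"
    by (intro sum.mono_neutral_right) (auto simp: sphere_weight_def)
  finally show ?thesis .
qed

section \<open>Reproducing polynomials\<close>

text \<open>Up to the factor \<open>\<alpha>\<close>, the polynomial \<open>p\<close> represents evaluation at \<open>0\<close> with respect to the
  discrete inner product with weights \<open>w\<close> on the polynomials of degree at most \<open>s\<close>. For
  the weights of a Johnson scheme this singles out the sum of the first \<open>s + 1\<close> zonal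
  polynomials.\<close>

definition reproducing :: "nat \<Rightarrow> (nat \<Rightarrow> rat) \<Rightarrow> nat \<Rightarrow> rat poly \<Rightarrow> rat \<Rightarrow> bool" where
  "reproducing m w s p \<alpha> \<longleftrightarrow> degree p \<le> s \<and>
     (\<forall>g. degree g \<le> s \<longrightarrow> (\<Sum>d\<le>m. w d * (poly g (of_nat d) * poly p (of_nat d))) = \<alpha> * poly g 0)"

text \<open>The combination \<open>h\<close> of \<open>p\<close> and \<open>q\<close> in which evaluation at \<open>0\<close> cancels is orthogonal to every
  polynomial of degree at most \<open>s\<close>, hence to itself. Positive weights force it to vanish at
  \<open>m + 1 > s\<close> points.\<close>

lemma reproducing_unique:
  assumes "s \<le> m" and w: "\<And>d. d \<le> m \<Longrightarrow> w d > 0"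
    and p: "reproducing m w s p \<alpha>" and q: "reproducing m w s q \<beta>"
  shows "smult \<beta> p = smult \<alpha> q"
proof -
  define h where "h = smult \<beta> p - smult \<alpha> q"
  have "degree h \<le> s"
    using p q unfolding h_def reproducing_def
    by (metis degree_diff_le degree_smult_le order.trans)
  then have "(\<Sum>d\<le>m. w d * (poly h (of_nat d) * poly p (of_nat d))) = \<alpha> * poly h 0"
    "(\<Sum>d\<le>m. w d * (poly h (of_nat d) * poly q (of_nat d))) = \<beta> * poly h 0"
    using p q by (auto simp: reproducing_def)
  then have "0 = \<beta> * (\<Sum>d\<le>m. w d * (poly h (of_nat d) * poly p (of_nat d)))
      - \<alpha> * (\<Sum>d\<le>m. w d * (poly h (of_nat d) * poly q (of_nat d)))" by simp
  also have "\<dots> = (\<Sum>d\<le>m. w d * (poly h (of_nat d))\<^sup>2)"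
    by (simp add: sum_distrib_left sum_subtractf[symmetric] h_def power2_eq_square algebra_simps)
  finally have "(\<Sum>d\<le>m. w d * (poly h (of_nat d))\<^sup>2) = 0" by simp
  then have "\<forall>d\<in>{..m}. w d * (poly h (of_nat d))\<^sup>2 = 0"
    by (subst (asm) sum_nonneg_eq_0_iff) (auto intro: mult_nonneg_nonneg less_imp_le[OF w])
  then have "w d * (poly h (of_nat d))\<^sup>2 = 0" if "d \<le> m" for d
    using that by simp
  then have zero: "poly h (of_nat d) = 0" if "d \<le> m" for d
    using w[OF that] that by (metis less_irrefl mult_eq_0_iff power_eq_0_iff)
  have "h = 0"
  proof (rule poly_eqI_degree[where A = "of_nat ` {..m}"])
    show "poly h x = poly 0 x" if "x \<in> of_nat ` {..m}" for x using zero that by auto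
    have "card (of_nat ` {..m} :: rat set) = Suc m" by (simp add: card_image inj_on_def)
    then show "card (of_nat ` {..m} :: rat set) > degree h" "card (of_nat ` {..m} :: rat set) > degree (0 :: rat poly)"
      using \<open>degree h \<le> s\<close> \<open>s \<le> m\<close> by auto
  qed
  then show ?thesis by (simp add: h_def)
qed

text \<open>The functions \<open>f (d(\<cdot>, c))\<close> for \<open>c\<close> in the code form a diagonal family, and there are
  as many of them as inclusion functions. Interpolating \<open>g (d(\<cdot>, y))\<close> by them and
  evaluating at \<open>y\<close> gives, for every point \<open>y\<close> of the slice,
  \<open>g 0 * f 0 = (\<Sum>c\<in>D. g (d(c, y)) * f (d(c, y)))\<close>. In the sum of this over all \<open>y\<close> every \<open>c\<close>
  contributes the same amount, namely the weighted sum over all distances.\<close>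

lemma reproducing_of_extremal_code:
  assumes "finite A" "k \<le> card A" "s \<le> k"
    and D: "D \<subseteq> slice A k" "card D = card A choose s"
    and L: "finite L" "card L \<le> s" "0 \<notin> L"
    and dist: "\<And>x y. x \<in> D \<Longrightarrow> y \<in> D \<Longrightarrow> x \<noteq> y \<Longrightarrow> johnson_dist k x y \<in> L"
  defines "f \<equiv> \<Prod>a\<in>L. [:- of_nat a, 1:]"
  shows "reproducing (card A - k) (sphere_weight k (card A - k)) s f
           (of_nat (card A choose k) * poly f 0 / of_nat (card A choose s))"
  unfolding reproducing_def
proof (intro conjI allI impI)
  have "degree f = card L"
    unfolding f_def by (subst degree_prod_eq_sum_degree) auto
  then show degf: "degree f \<le> s" using L by simp
  have f0: "poly f 0 \<noteq> 0" using L by (auto simp: f_def poly_prod)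
  have froot: "poly f (of_nat a) = 0" if "a \<in> L" for a
    using L that by (auto simp: f_def poly_prod)
  have finD: "finite D" using D(1) finite_slice[OF assms(1)] by (rule finite_subset)
  have selfdist: "johnson_dist k c c = 0" if "c \<in> slice A k" for c
    using that by (auto simp: johnson_dist_def slice_def)
  have sym: "johnson_dist k x y = johnson_dist k y x" for x y
    by (simp add: johnson_dist_def Int_commute)
  fix g :: "rat poly" assume g: "degree g \<le> s"
  let ?P = "slice A k"
  let ?h = "\<lambda>d. poly g (of_nat d) * poly f (of_nat d)"
  have point: "poly g 0 * poly f 0 = (\<Sum>c\<in>D. ?h (johnson_dist k c y))" if y: "y \<in> ?P" for y
  proof -
    have "dist_fun A k g y y = (\<Sum>c\<in>D. dist_fun A k g y c / dist_fun A k f c c * dist_fun A k f c y)"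
    proof (rule interpolation_from_diagonal_family[where B = "inclusion_fun A k ` slice A s"])
      show "finite (inclusion_fun A k ` slice A s)" using finite_slice[OF assms(1)] by simp
      show "card (inclusion_fun A k ` slice A s) \<le> card D"
        using card_image_le[OF finite_slice[OF assms(1)], of "inclusion_fun A k" s] card_slice[OF assms(1), of s] D
        by simp
      show "dist_fun A k f c \<in> fun_space.span (inclusion_fun A k ` slice A s)" if "c \<in> D" for c
        using that D by (intro dist_fun_in_span_inclusion_funs assms degf) auto
      show "dist_fun A k g y \<in> fun_space.span (inclusion_fun A k ` slice A s)"
        by (intro dist_fun_in_span_inclusion_funs assms g y)
      show "dist_fun A k f c c \<noteq> 0" if "c \<in> D" for c
        using that D f0 selfdist by (auto simp: dist_fun_def)
      show "dist_fun A k f c c' = 0" if "c \<in> D" "c' \<in> D" "c \<noteq> c'" for c c'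
        using dist[of c' c] froot that D by (auto simp: dist_fun_def)
    qed (rule finD)
    also have "\<dots> = (\<Sum>c\<in>D. ?h (johnson_dist k c y)) / poly f 0"
      unfolding sum_divide_distrib
      using D y selfdist by (intro sum.cong) (auto simp: dist_fun_def sym[of y])
    finally show ?thesis using f0 y selfdist by (simp add: dist_fun_def)
  qed
  have "of_nat (card A choose k) * (poly g 0 * poly f 0) = (\<Sum>y\<in>?P. poly g 0 * poly f 0)"
    by (simp add: card_slice[OF assms(1)])
  also have "\<dots> = (\<Sum>y\<in>?P. \<Sum>c\<in>D. ?h (johnson_dist k c y))"
    using point by (intro sum.cong) auto
  also have "\<dots> = (\<Sum>c\<in>D. \<Sum>y\<in>?P. ?h (johnson_dist k c y))" by (rule sum.swap)
  also have "\<dots> = (\<Sum>c\<in>D. \<Sum>d\<le>card A - k. sphere_weight k (card A - k) d * ?h d)"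
  proof (rule sum.cong)
    fix c assume "c \<in> D"
    then have "c \<in> ?P" using D by auto
    then show "(\<Sum>y\<in>?P. ?h (johnson_dist k c y)) = (\<Sum>d\<le>card A - k. sphere_weight k (card A - k) d * ?h d)"
      by (rule sum_over_slice_by_distance[OF assms(1)])
  qed simp
  also have "\<dots> = of_nat (card A choose s) * (\<Sum>d\<le>card A - k. sphere_weight k (card A - k) d * ?h d)"
    by (simp add: D)
  finally show "(\<Sum>d\<le>card A - k. sphere_weight k (card A - k) d * ?h d)
      = of_nat (card A choose k) * poly f 0 / of_nat (card A choose s) * poly g 0"
    using assms(2,3) by (simp add: field_simps)
qed

section \<open>Finite differences of monic products\<close>

text \<open>The \<open>s\<close>-th difference at \<open>0\<close> of a monic polynomial of degree \<open>s\<close> is \<open>s!\<close>, and it vanishes in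
  lower degree. A product of linear factors can be treated without passing to
  coefficients: the factor \<open>i\<close> is absorbed by \<open>i (s choose i) = s (s - 1 choose i - 1)\<close>, which lowers
  \<open>s\<close>, and the remaining constant multiplies a product with fewer factors.\<close>

lemma finite_difference_prod_linear:
  fixes a :: "nat \<Rightarrow> 'a::field_char_0"
  assumes "m \<le> s"
  shows "(\<Sum>i\<le>s. (-1) ^ (s - i) * of_nat (s choose i) * (\<Prod>t<m. of_nat i + a t))
       = (if m = s then fact s else 0)"
  using assms
proof (induction s arbitrary: m a)
  case 0
  then show ?case by simp
next
  case (Suc s)
  note IH = Suc.IH
  let ?T = "\<lambda>s F. \<Sum>i\<le>s. (-1) ^ (s - i) * of_nat (s choose i) * (F i :: 'a)"
  have one: "?T (Suc s) (\<lambda>i. 1) = 0"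
    using binomial_ring[of "1 :: 'a" "-1" "Suc s"] by (simp add: mult.commute)
  have absorb: "?T (Suc s) (\<lambda>i. of_nat i * F i) = of_nat (Suc s) * ?T s (\<lambda>i. F (Suc i))" for F
  proof -
    have "?T (Suc s) (\<lambda>i. of_nat i * F i)
        = (\<Sum>i\<le>s. (-1) ^ (s - i) * (of_nat (Suc i * (Suc s choose Suc i))) * F (Suc i))"
      by (subst sum.atMost_Suc_shift) (simp add: algebra_simps)
    also have "\<dots> = of_nat (Suc s) * ?T s (\<lambda>i. F (Suc i))"
      unfolding binomial_absorption sum_distrib_left by (simp add: algebra_simps)
    finally show ?thesis .
  qed
  show ?case
    using Suc.prems
  proof (induction m)
    case 0
    show ?case using one by simp
  next
    case (Suc m)
    let ?Q = "\<lambda>i. \<Prod>t<m. of_nat i + a t"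
    have "?T (Suc s) (\<lambda>i. \<Prod>t<Suc m. of_nat i + a t)
        = ?T (Suc s) (\<lambda>i. of_nat i * ?Q i) + a m * ?T (Suc s) ?Q"
      unfolding sum_distrib_left sum.distrib[symmetric]
      by (intro sum.cong) (simp_all add: algebra_simps)
    also have "?T (Suc s) ?Q = 0" using Suc by simp
    also have "?T (Suc s) (\<lambda>i. of_nat i * ?Q i)
        = of_nat (Suc s) * ?T s (\<lambda>i. \<Prod>t<m. of_nat i + (1 + a t))"
      unfolding absorb by (simp add: algebra_simps)
    also have "?T s (\<lambda>i. \<Prod>t<m. of_nat i + (1 + a t)) = (if m = s then fact s else 0)"
      using Suc.prems by (intro IH) simp
    finally show ?case by simp
  qed
qed

section \<open>The reproducing property of \<open>\<Phi>\<^sub>s\<close>\<close>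

lemma falling_fact_eq_pochhammer: "falling_fact (x + of_nat m - 1) m = pochhammer x m"
proof -
  have "falling_fact (x + of_nat m - 1) m = (\<Prod>j<m. x + of_nat (m - Suc j))"
    unfolding falling_fact_def by (intro prod.cong) (simp_all add: of_nat_diff algebra_simps)
  also have "\<dots> = (\<Prod>j<m. x + of_nat j)"
    by (rule prod.nat_diff_reindex)
  finally show ?thesis by (simp add: pochhammer_prod atLeast0LessThan)
qed

text \<open>The duplication formula removes the floors: the half-integral factorial and the powers of 2
  combine to the quotient of rising factorials of \<open>r\<close> and \<open>2 r\<close>, which is the \<open>i\<close>-th moment of
  the Beta distribution with both parameters \<open>r\<close>. So \<open>\<Phi>\<^sub>s\<close> is a
  hypergeometric polynomial.\<close>

lemma Phi_coeff_eq:
  assumes "r > 0"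
  shows "Phi_coeff r s i = of_nat (s choose i) * pochhammer (of_nat r + 1) i
           * (pochhammer (of_nat r) i / pochhammer (2 * of_nat r) i)"
proof -
  define m where "m = i div 2"
  let ?r = "of_nat r :: rat"
  have pos: "pochhammer (?r + 1 / 2) m \<noteq> 0" "pochhammer (2 * ?r) i \<noteq> 0" "pochhammer ?r m \<noteq> 0" 
      "pochhammer ?r (Suc m) \<noteq> 0"
    using assms by (auto intro!: less_imp_neq[symmetric] pochhammer_pos)
  have "falling_fact (?r + of_nat i - 1) m * pochhammer (2 * ?r) i
      = 2 ^ i * pochhammer (?r + 1 / 2) m * pochhammer ?r i"
  proof (cases "even i")
    case True
    then have i: "i = 2 * m" by (simp add: m_def)
    have "falling_fact (?r + of_nat i - 1) m = pochhammer (?r + of_nat m) m"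
      using falling_fact_eq_pochhammer[of "?r + of_nat m" m] by (simp add: i algebra_simps)
    moreover have "pochhammer ?r i = pochhammer ?r m * pochhammer (?r + of_nat m) m"
      using pochhammer_product'[of ?r m m] by (simp add: i mult_2)
    moreover have "pochhammer (2 * ?r) i = 2 ^ i * pochhammer ?r m * pochhammer (?r + 1 / 2) m"
      using pochhammer_double[of ?r m] by (simp add: i)
    ultimately show ?thesis by simp
  next
    case False
    then have i: "i = Suc (2 * m)" by (simp add: m_def)
    have "falling_fact (?r + of_nat i - 1) m = pochhammer (?r + of_nat (Suc m)) m"
      using falling_fact_eq_pochhammer[of "?r + of_nat (Suc m)" m] by (simp add: i algebra_simps)
    moreover have "pochhammer ?r i = pochhammer ?r (Suc m) * pochhammer (?r + of_nat (Suc m)) m"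
      using pochhammer_product'[of ?r "Suc m" m] by (simp add: i mult_2)
    moreover have "pochhammer (2 * ?r) i = 2 ^ i * pochhammer ?r (Suc m) * pochhammer (?r + 1 / 2) m"
      using pochhammer_double[of ?r m] by (simp add: i pochhammer_Suc algebra_simps)
    ultimately show ?thesis by simp
  qed
  then have "falling_fact (?r + of_nat i - 1) m / (2 ^ i * pochhammer (?r + 1 / 2) m)
      = pochhammer ?r i / pochhammer (2 * ?r) i"
    using pos by (simp add: field_simps)
  moreover have "Phi_coeff r s i = of_nat (s choose i) * pochhammer (?r + 1) i
      * (falling_fact (?r + of_nat i - 1) m / (2 ^ i * pochhammer (?r + 1 / 2) m))"
    by (simp add: Phi_coeff_def m_def[symmetric] mult_ac)
  ultimately show ?thesis by simp
qed

lemma choose_mult_falling_fact: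
  assumes "d \<le> n" "k \<le> n"
  shows "of_nat (n choose d) * falling_fact (of_nat d) k
       = (falling_fact (of_nat n) k * of_nat ((n - k) choose (n - d)) :: rat)"
proof (cases "k \<le> d")
  case True
  have "(n choose d) * (d choose k) = (n choose k) * ((n - k) choose (d - k))"
    using True assms by (simp add: choose_mult)
  also have "(n - k) choose (d - k) = (n - k) choose (n - d)"
    using True assms binomial_symmetric[of "d - k" "n - k"] by simp
  finally have "(of_nat (n choose d) * of_nat (d choose k) :: rat)
      = of_nat (n choose k) * of_nat ((n - k) choose (n - d))"
    by (metis of_nat_mult)
  then show ?thesis by (simp add: falling_fact_of_nat)
next
  case False
  then show ?thesis using assms by (simp add: falling_fact_of_nat binomial_eq_0)
qed

text \<open>Each falling factorial is absorbed by one of the two binomial coefficients of the weight, and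
  what remains is a Vandermonde convolution.\<close>

lemma sphere_weight_moments:
  assumes "m \<le> n" "k \<le> n" "j \<le> m"
  shows "(\<Sum>d\<le>m. sphere_weight n m d * (falling_fact (of_nat m - of_nat d) j * falling_fact (of_nat d) k))
       = falling_fact (of_nat n) k * falling_fact (of_nat m) j * of_nat ((n + m - k - j) choose n)"
proof -
  have "(\<Sum>d\<le>m. sphere_weight n m d * (falling_fact (of_nat m - of_nat d) j * falling_fact (of_nat d) k))
      = (\<Sum>d\<le>m. falling_fact (of_nat n) k * falling_fact (of_nat m) j
          * of_nat (((m - j) choose d) * ((n - k) choose (n - d))))"
  proof (rule sum.cong)
    fix d assume d: "d \<in> {..m}"
    then have "of_nat (m choose d) * falling_fact (of_nat m - of_nat d) j
        = (falling_fact (of_nat m) j * of_nat ((m - j) choose d) :: rat)"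
      using choose_mult_falling_fact[of "m - d" m j] assms
      by (simp add: binomial_symmetric[of d m] of_nat_diff)
    moreover have "of_nat (n choose d) * falling_fact (of_nat d) k
        = (falling_fact (of_nat n) k * of_nat ((n - k) choose (n - d)) :: rat)"
      using choose_mult_falling_fact[of d n k] assms d by simp
    moreover have "sphere_weight n m d * (falling_fact (of_nat m - of_nat d) j * falling_fact (of_nat d) k)
        = (of_nat (m choose d) * falling_fact (of_nat m - of_nat d) j)
          * (of_nat (n choose d) * falling_fact (of_nat d) k)"
      by (simp add: sphere_weight_def)
    ultimately show "sphere_weight n m d * (falling_fact (of_nat m - of_nat d) j * falling_fact (of_nat d) k)
        = falling_fact (of_nat n) k * falling_fact (of_nat m) j * of_nat (((m - j) choose d) * ((n - k) choose (n - d)))"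
      by (simp only: of_nat_mult mult_ac)
  qed simp
  also have "\<dots> = falling_fact (of_nat n) k * falling_fact (of_nat m) j
      * of_nat (\<Sum>d\<le>m. ((m - j) choose d) * ((n - k) choose (n - d)))"
    by (simp add: sum_distrib_left)
  also have "(\<Sum>d\<le>m. ((m - j) choose d) * ((n - k) choose (n - d)))
      = (\<Sum>d\<le>n. ((m - j) choose d) * ((n - k) choose (n - d)))"
    using assms by (intro sum.mono_neutral_left) auto
  also have "\<dots> = (m - j + (n - k)) choose n" by (rule vandermonde)
  also have "m - j + (n - k) = n + m - k - j" using assms by simp
  finally show ?thesis .
qed

lemma pochhammer_Suc_of_nat: "fact y * pochhammer (of_nat (Suc y)) i = (fact (y + i) :: rat)"
  using pochhammer_product'[of "1 :: rat" y i] by (simp add: pochhammer_fact)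

lemma falling_fact_of_nat_fact: "j \<le> w \<Longrightarrow> falling_fact (of_nat w) j = (fact w / fact (w - j) :: rat)"
  by (simp add: falling_fact_of_nat binomial_fact)

text \<open>The identity behind the reproducing property: after multiplication by the binomial coefficient
  from the Vandermonde sum, the Beta moment is, up to a constant independent of \<open>i\<close> and
  \<open>j\<close>, a monic polynomial of degree \<open>s\<close> in \<open>i\<close>. With \<open>q = r - 1\<close>, the first \<open>j\<close> factors are those of
  \<open>(q + i)! / (q + i - j)!\<close>, the other \<open>s - j\<close> those of
  \<open>(2 r + s + i - 1 - j)! / (2 r + i - 1)!\<close>.\<close>

lemma beta_moment_term:
  fixes q s i j :: nat
  defines "r \<equiv> Suc q"
  assumes "j \<le> s"
  shows "pochhammer (of_nat r) i / pochhammer (2 * of_nat r) i * of_nat ((2 * r + s + i - 1 - j) choose (r + s))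
       = fact (2 * r - 1) / (fact q * fact (r + s))
         * (\<Prod>t<s. of_nat i + (if t < j then of_nat q - of_nat t else 2 * of_nat r + of_nat (t - j)) :: rat)"
proof -
  let ?a = "\<lambda>t. of_nat i + (if t < j then of_nat q - of_nat t else 2 * of_nat r + of_nat (t - j)) :: rat"
  have "(\<Prod>t<s. ?a t) = (\<Prod>t<j. ?a t) * (\<Prod>t\<in>{j..<s}. ?a t)"
    using prod.atLeastLessThan_concat[of 0 j s ?a] assms by (simp only: lessThan_atLeast0 zero_le)
  also have "(\<Prod>t<j. ?a t) = falling_fact (of_nat (q + i)) j"
    unfolding falling_fact_def by (intro prod.cong) (auto simp: algebra_simps)
  also have "(\<Prod>t\<in>{j..<s}. ?a t) = (\<Prod>t\<in>{0..<s-j}. ?a (t + j))"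
    using prod.shift_bounds_nat_ivl[of ?a 0 j "s - j"] assms by simp
  also have "\<dots> = pochhammer (of_nat (Suc (2 * r - 1 + i))) (s - j)"
    unfolding pochhammer_prod by (intro prod.cong) (auto simp: r_def algebra_simps)
  finally have prod: "(\<Prod>t<s. ?a t)
      = falling_fact (of_nat (q + i)) j * pochhammer (of_nat (Suc (2 * r - 1 + i))) (s - j)" .
  have p1: "pochhammer (of_nat (Suc (2 * r - 1 + i))) (s - j) = (fact (2 * r - 1 + i + (s - j)) / fact (2 * r - 1 + i) :: rat)"
    using pochhammer_Suc_of_nat[of "2 * r - 1 + i" "s - j"] by (simp add: field_simps del: of_nat_Suc)
  have p2: "pochhammer (of_nat r) i = (fact (q + i) / fact q :: rat)"
    using pochhammer_Suc_of_nat[of q i] by (simp add: r_def field_simps del: of_nat_Suc)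
  have twice: "(2 * of_nat r :: rat) = of_nat (Suc (2 * r - 1))" by (simp add: r_def)
  have p3: "pochhammer (2 * of_nat r) i = (fact (2 * r - 1 + i) / fact (2 * r - 1) :: rat)"
    unfolding twice using pochhammer_Suc_of_nat[of "2 * r - 1" i] by (simp add: field_simps del: of_nat_Suc)
  show ?thesis
  proof (cases "j \<le> q + i")
    case True
    have N: "2 * r + s + i - 1 - j = 2 * r - 1 + i + (s - j)" using assms by (simp add: r_def)
    have "2 * r - 1 + i + (s - j) - (r + s) = q + i - j" using assms True by (simp add: r_def)
    moreover have "r + s \<le> 2 * r - 1 + i + (s - j)" using assms True by (simp add: r_def)
    ultimately have "of_nat ((2 * r - 1 + i + (s - j)) choose (r + s))
        = (fact (2 * r - 1 + i + (s - j)) / (fact (r + s) * fact (q + i - j)) :: rat)"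
      by (simp add: binomial_fact)
    then show ?thesis
      unfolding prod p1 p2 p3 N falling_fact_of_nat_fact[OF True] by (simp add: mult_ac)
  next
    case False
    \<comment> \<open>The binomial coefficient is \<open>0\<close>, and so is the factor of the product with \<open>t = q + i\<close>.\<close>
    then have "2 * r + s + i - 1 - j < r + s" using assms by (simp add: r_def)
    then show ?thesis using False by (simp add: prod falling_fact_of_nat binomial_eq_0 del: of_nat_add)
  qed
qed

text \<open>Tested against the \<open>j\<close>-th falling factorial of \<open>n - 1 - z\<close>, the sum becomes the \<open>s\<close>-th
  difference of a monic polynomial of degree \<open>s\<close>, whatever \<open>j\<close> is. The only dependence on \<open>j\<close> is then
  through the value of the test polynomial at \<open>0\<close>.\<close>

lemma Phi_reproducing:
  assumes "r > 0" and n: "n = r + s"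
  shows "reproducing (n - 1) (sphere_weight n (n - 1)) s (Phi r s)
           (fact s * fact (2 * r - 1) / (fact r * fact (r - 1)))"
    (is "reproducing ?m ?w s _ ?\<mu>")
  unfolding reproducing_def
proof (intro conjI allI impI)
  show "degree (Phi r s) \<le> s"
    unfolding Phi_def
  proof (intro degree_sum_le)
    fix i assume i: "i \<in> {..s}"
    have "degree ((-1) ^ (s - i) * falling_fact [:0, 1 :: rat:] (s - i) * [:Phi_coeff r s i:]) \<le> (0 + (s - i)) + 0"
      by (intro order.trans[OF degree_mult_le] add_mono)
         (simp_all add: degree_power_eq degree_falling_fact_linear)
    then show "degree ((-1) ^ (s - i) * falling_fact [:0, 1 :: rat:] (s - i) * [:Phi_coeff r s i:]) \<le> s"
      by simp
  qed simp
  obtain q where q: "r = Suc q" using \<open>r > 0\<close> gr0_implies_Suc by blast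
  fix g :: "rat poly" assume "degree g \<le> s"
  then show "(\<Sum>d\<le>?m. ?w d * (poly g (of_nat d) * poly (Phi r s) (of_nat d))) = ?\<mu> * poly g 0"
  proof (induction rule: poly_induct_graded_basis[where B = "falling_fact [:of_nat ?m, -1:]"])
    case (basis j)
    let ?g = "falling_fact [:of_nat ?m, -1 :: rat:] j"
    have g: "poly ?g x = falling_fact (of_nat ?m - x) j" for x
      by (simp add: poly_falling_fact)
    have Phi: "poly (Phi r s) x = (\<Sum>i\<le>s. (-1) ^ (s - i) * falling_fact x (s - i) * Phi_coeff r s i)" for x
      by (simp add: Phi_def poly_sum poly_falling_fact poly_power mult_ac)
    have "(\<Sum>d\<le>?m. ?w d * (poly ?g (of_nat d) * poly (Phi r s) (of_nat d)))
        = (\<Sum>d\<le>?m. \<Sum>i\<le>s. (-1) ^ (s - i) * Phi_coeff r s i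
            * (?w d * (falling_fact (of_nat ?m - of_nat d) j * falling_fact (of_nat d) (s - i))))"
      unfolding g Phi sum_distrib_left by (intro sum.cong) (simp_all add: algebra_simps)
    also have "\<dots> = (\<Sum>i\<le>s. (-1) ^ (s - i) * Phi_coeff r s i
            * (\<Sum>d\<le>?m. ?w d * (falling_fact (of_nat ?m - of_nat d) j * falling_fact (of_nat d) (s - i))))"
      unfolding sum_distrib_left by (rule sum.swap)
    also have "\<dots> = (\<Sum>i\<le>s. ?\<mu> / fact s * falling_fact (of_nat ?m) j * ((-1) ^ (s - i) * of_nat (s choose i)
        * (\<Prod>t<s. of_nat i + (if t < j then of_nat q - of_nat t else 2 * of_nat r + of_nat (t - j)))))"
    proof (rule sum.cong)
      fix i assume "i \<in> {..s}"
      then have i: "i \<le> s" by simp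
      let ?pr = "(\<Prod>t<s. of_nat i + (if t < j then of_nat q - of_nat t else 2 * of_nat r + of_nat (t - j))) :: rat"
      let ?bin = "of_nat ((2 * r + s + i - 1 - j) choose (r + s)) :: rat"
      have N: "n + ?m - (s - i) - j = 2 * r + s + i - 1 - j" using i n by simp
      have moment: "(\<Sum>d\<le>?m. ?w d * (falling_fact (of_nat ?m - of_nat d) j * falling_fact (of_nat d) (s - i)))
          = falling_fact (of_nat n) (s - i) * falling_fact (of_nat ?m) j * ?bin"
        using i n basis \<open>r > 0\<close> sphere_weight_moments[of ?m n "s - i" j] unfolding N by simp
      have "falling_fact (of_nat n) (s - i) = (fact n / fact (r + i) :: rat)"
        using i n falling_fact_of_nat_fact[of "s - i" n] by simp
      moreover have "pochhammer (of_nat r + 1) i = (fact (r + i) / fact r :: rat)"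
        using pochhammer_Suc_of_nat[of r i] by (simp add: field_simps)
      ultimately have const: "pochhammer (of_nat r + 1) i * falling_fact (of_nat n) (s - i) = (fact n / fact r :: rat)"
        by simp
      have "Phi_coeff r s i * (falling_fact (of_nat n) (s - i) * falling_fact (of_nat ?m) j * ?bin)
          = of_nat (s choose i) * falling_fact (of_nat ?m) j
            * (pochhammer (of_nat r + 1) i * falling_fact (of_nat n) (s - i))
            * (pochhammer (of_nat r) i / pochhammer (2 * of_nat r) i * ?bin)"
        by (simp add: Phi_coeff_eq[OF \<open>r > 0\<close>])
      also have "\<dots> = of_nat (s choose i) * falling_fact (of_nat ?m) j * (fact n / fact r)
            * (fact (2 * r - 1) / (fact q * fact (r + s)) * ?pr)"
        unfolding const using beta_moment_term[of j s q i] basis by (simp only: q)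
      also have "\<dots> = ?\<mu> / fact s * falling_fact (of_nat ?m) j * (of_nat (s choose i) * ?pr)"
        by (simp add: n q mult_ac)
      finally show "(-1) ^ (s - i) * Phi_coeff r s i
          * (\<Sum>d\<le>?m. ?w d * (falling_fact (of_nat ?m - of_nat d) j * falling_fact (of_nat d) (s - i)))
          = ?\<mu> / fact s * falling_fact (of_nat ?m) j * ((-1) ^ (s - i) * of_nat (s choose i) * ?pr)"
        unfolding moment by (simp only: mult.assoc) (simp only: mult.left_commute)
    qed simp
    also have "\<dots> = ?\<mu> / fact s * falling_fact (of_nat ?m) j * fact s"
      unfolding sum_distrib_left[symmetric] by (subst finite_difference_prod_linear) simp_all
    also have "\<dots> = ?\<mu> * poly ?g 0" by (subst g) simp
    finally show ?case using degree_falling_fact_linear[of "-1 :: rat" "of_nat ?m" j] by simp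
  next
    case (add p q)
    then show ?case by (simp add: algebra_simps sum.distrib)
  next
    case (smult c p)
    have "(\<Sum>d\<le>?m. ?w d * (poly (smult c p) (of_nat d) * poly (Phi r s) (of_nat d)))
        = c * (\<Sum>d\<le>?m. ?w d * (poly p (of_nat d) * poly (Phi r s) (of_nat d)))"
      by (simp add: sum_distrib_left algebra_simps)
    then show ?case using smult by simp
  qed
qed

section \<open>Folding a symmetric code into a smaller Johnson scheme\<close>

lemma johnson_dist_complement:
  assumes "x \<in> johnson_points n" "y \<in> johnson_points n"
  shows "johnson_dist n ({1..2 * n} - x) y = n - johnson_dist n x y"
proof -
  have y: "y \<subseteq> {1..2 * n}" "card y = n" using assms by (auto simp: johnson_points_def)
  have "finite y" using y(1) by (rule finite_subset) simp
  then have "card y = card (x \<inter> y) + card (y - x)" by (metis Int_commute card_Int_Diff)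
  moreover have "({1..2 * n} - x) \<inter> y = y - x" using y by auto
  ultimately show ?thesis using y by (simp add: johnson_dist_def)
qed

lemma complement_johnson_point:
  assumes "x \<in> johnson_points n"
  shows "{1..2 * n} - x \<in> johnson_points n"
proof -
  have x: "x \<subseteq> {1..2 * n}" "card x = n" using assms by (auto simp: johnson_points_def)
  have "finite x" using x(1) by (rule finite_subset) simp
  then show ?thesis using x by (simp add: johnson_points_def card_Diff_subset)
qed

lemma johnson_dist_complements:
  assumes "x \<in> johnson_points n" "y \<in> johnson_points n"
  shows "johnson_dist n ({1..2 * n} - x) ({1..2 * n} - y) = johnson_dist n x y"
proof -
  have comm: "johnson_dist n u v = johnson_dist n v u" for u v
    by (simp add: johnson_dist_def Int_commute)
  have "johnson_dist n ({1..2 * n} - x) ({1..2 * n} - y) = n - johnson_dist n x ({1..2 * n} - y)"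
    using assms by (intro johnson_dist_complement complement_johnson_point)
  also have "johnson_dist n x ({1..2 * n} - y) = n - johnson_dist n x y"
    using johnson_dist_complement[OF assms(2,1)] by (simp add: comm)
  finally show ?thesis by (simp add: johnson_dist_def)
qed

lemma johnson_dist_eq_0_imp_eq:
  assumes "x \<in> johnson_points n" "y \<in> johnson_points n" "johnson_dist n x y = 0"
  shows "x = y"
proof -
  have xy: "x \<subseteq> {1..2 * n}" "y \<subseteq> {1..2 * n}" "card x = n" "card y = n" 
    using assms by (auto simp: johnson_points_def)
  have fin: "finite x" "finite y" using xy(1,2) by (auto intro: finite_subset)
  have "n \<le> card (x \<inter> y)" using assms(3) by (simp add: johnson_dist_def)
  then have "x \<inter> y = x" "x \<inter> y = y"
    using fin xy by (metis card_seteq inf_le1, metis card_seteq inf_le2)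
  then show ?thesis by simp
qed

text \<open>The distance \<open>n\<close> cannot occur, since by symmetry \<open>0\<close> would occur too; so a symmetric
  code contains no two complementary points.\<close>

lemma degree_set_symmetric_code:
  assumes "symmetric_code n C"
  shows "degree_set n C \<subseteq> {1..<n}"
proof
  fix a assume a: "a \<in> degree_set n C"
  have "0 \<notin> degree_set n C"
    using assms johnson_dist_eq_0_imp_eq by (fastforce simp: degree_set_def symmetric_code_def)
  moreover have "n - a \<in> degree_set n C" using a assms by (simp add: symmetric_code_def)
  ultimately show "a \<in> {1..<n}" using a by (cases "a = 0"; cases "a < n") auto
qed

text \<open>Of each complementary pair of points, the one that avoids \<open>2 n\<close> is kept. This turns
  points of \<open>J(2n, n)\<close> into \<open>n\<close>-subsets of a set of size \<open>2 n - 1\<close>.\<close>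

definition fold_point :: "nat \<Rightarrow> nat set \<Rightarrow> nat set" where
  "fold_point n x = (if 2 * n \<in> x then {1..2 * n} - x else x)"

text \<open>Complementing one of two points changes their distance \<open>a\<close> to \<open>n - a\<close>, complementing both
  leaves it alone. Symmetry of the degree set therefore keeps all distances inside it. They are
  positive, so folding identifies no two points of the code.\<close>

lemma folded_symmetric_code:
  assumes "symmetric_code n C" "n > 0"
  shows "fold_point n ` C \<subseteq> slice {1..2 * n - 1} n"
    and "inj_on (fold_point n) C"
    and "\<And>x y. x \<in> fold_point n ` C \<Longrightarrow> y \<in> fold_point n ` C \<Longrightarrow> x \<noteq> y \<Longrightarrow> johnson_dist n x y \<in> degree_set n C"
proof -
  have C: "x \<in> johnson_points n" if "x \<in> C" for x
    using assms that by (auto simp: symmetric_code_def)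
  have dist: "johnson_dist n x y \<in> degree_set n C" if "x \<in> C" "y \<in> C" "x \<noteq> y" for x y
    using that by (auto simp: degree_set_def)
  have comm: "johnson_dist n u v = johnson_dist n v u" for u v
    by (simp add: johnson_dist_def Int_commute)
  have folded: "johnson_dist n (fold_point n x) (fold_point n y) \<in> degree_set n C"
    if "x \<in> C" "y \<in> C" "x \<noteq> y" for x y
  proof -
    have "johnson_dist n (fold_point n x) (fold_point n y) \<in> {johnson_dist n x y, n - johnson_dist n x y}"
      using johnson_dist_complement[of x n y] johnson_dist_complement[of y n x]
        johnson_dist_complements[of x n y] C that
      by (auto simp: fold_point_def comm)
    then show ?thesis using dist[OF that] assms by (auto simp: symmetric_code_def)
  qed
  show "fold_point n ` C \<subseteq> slice {1..2 * n - 1} n"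
  proof
    fix z assume "z \<in> fold_point n ` C"
    then obtain x where x: "x \<in> C" "z = fold_point n x" by auto
    have "z \<in> johnson_points n"
      using x C complement_johnson_point by (auto simp: fold_point_def)
    moreover have "2 * n \<notin> z" using x by (auto simp: fold_point_def)
    moreover have "{1..2 * n} = insert (2 * n) {1..2 * n - 1}" using \<open>n > 0\<close> by auto
    ultimately show "z \<in> slice {1..2 * n - 1} n"
      by (auto simp: slice_def johnson_points_def)
  qed
  show "inj_on (fold_point n) C"
  proof (rule inj_onI, rule ccontr)
    fix x y assume xy: "x \<in> C" "y \<in> C" "fold_point n x = fold_point n y" "x \<noteq> y"
    have "fold_point n y \<in> johnson_points n"
      using xy C complement_johnson_point by (auto simp: fold_point_def)
    then have "johnson_dist n (fold_point n x) (fold_point n y) = 0"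
      using xy by (simp add: johnson_dist_def johnson_points_def)
    then show False
      using folded[OF xy(1,2,4)] degree_set_symmetric_code[OF assms(1)] by auto
  qed
  show "johnson_dist n x y \<in> degree_set n C"
    if "x \<in> fold_point n ` C" "y \<in> fold_point n ` C" "x \<noteq> y" for x y
    using that folded by auto
qed

section \<open>The zeros of \<open>\<Phi>\<^sub>s\<close>\<close>

lemma map_poly_of_rat_mult:
  "map_poly of_rat (p * q) = (map_poly of_rat p * map_poly of_rat q :: 'a::field_char_0 poly)"
  by (rule poly_eqI) (simp add: coeff_map_poly coeff_mult of_rat_sum of_rat_mult)

lemma map_poly_of_rat_prod:
  "map_poly of_rat (\<Prod>a\<in>S. f a) = (\<Prod>a\<in>S. map_poly of_rat (f a) :: 'a::field_char_0 poly)"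
  by (induction S rule: infinite_finite_induct) (simp_all add: map_poly_of_rat_mult)

lemma proots_prod_linear:
  fixes g :: "'b \<Rightarrow> 'a::idom"
  assumes "finite S" "inj_on g S"
  shows "proots (\<Prod>a\<in>S. [:- g a, 1:]) = mset_set (g ` S)"
proof -
  have "proots (\<Prod>a\<in>S. [:- g a, 1:]) = (\<Sum>a\<in>S. {#g a#})"
    by (subst proots_prod) auto
  also have "\<dots> = (\<Sum>z\<in>g ` S. {#z#})" by (subst sum.reindex[OF assms(2)]) simp
  finally show ?thesis by simp
qed

text \<open>Both polynomials are reproducing for the same weights, \<open>\<Phi>\<^sub>s\<close> by a computation and the
  annihilator of the degree set because the folded code is extremal.\<close>

lemma Phi_eq_smult_annihilator:
  assumes "r > 0" and "s > 0" and n: "n = r + s" and C: "tight_symmetric_code n s C"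
  shows "\<exists>c. c \<noteq> 0 \<and> Phi r s = smult c (\<Prod>a\<in>degree_set n C. [:- of_nat a, 1:])"
proof -
  define L where "L = degree_set n C"
  define D where "D = fold_point n ` C"
  let ?f = "\<Prod>a\<in>L. [:- of_nat a, 1 :: rat:]"
  have sym: "symmetric_code n C" and "card L = s" and "card C = (2 * n - 1) choose s"
    using C by (auto simp: tight_symmetric_code_def code_degree_def L_def)
  have L: "L \<subseteq> {1..<n}" using degree_set_symmetric_code[OF sym] by (simp add: L_def)
  have "n > 0" using assms by simp
  note fold = folded_symmetric_code[OF sym \<open>n > 0\<close>]
  have m: "2 * n - 1 - n = n - 1" by simp
  define \<beta> where "\<beta> = of_nat ((2 * n - 1) choose n) * poly ?f 0 / of_nat ((2 * n - 1) choose s)"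
  have "finite L" using L by (rule finite_subset) simp
  have "reproducing (card {1..2 * n - 1} - n) (sphere_weight n (card {1..2 * n - 1} - n)) s ?f
      (of_nat (card {1..2 * n - 1} choose n) * poly ?f 0 / of_nat (card {1..2 * n - 1} choose s))"
  proof (rule reproducing_of_extremal_code[where D = D])
    show "card D = card {1..2 * n - 1} choose s"
      using \<open>card C = _\<close> fold(2) by (simp add: D_def card_image)
  qed (use fold L \<open>card L = s\<close> \<open>finite L\<close> n \<open>n > 0\<close> in \<open>auto simp: D_def L_def\<close>)
  then have f: "reproducing (n - 1) (sphere_weight n (n - 1)) s ?f \<beta>"
    unfolding card_atLeastAtMost diff_Suc_1 m \<beta>_def by simp
  have "poly ?f 0 \<noteq> 0" using L \<open>finite L\<close> by (auto simp: poly_prod)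
  moreover have "n \<le> 2 * n - 1" "s \<le> 2 * n - 1" using n \<open>r > 0\<close> by auto
  ultimately have "\<beta> \<noteq> 0" by (simp add: \<beta>_def)
  define \<mu> :: rat where "\<mu> = fact s * fact (2 * r - 1) / (fact r * fact (r - 1))"
  have "\<mu> \<noteq> 0" by (simp add: \<mu>_def)
  have "smult \<beta> (Phi r s) = smult \<mu> ?f"
  proof (rule reproducing_unique)
    show "reproducing (n - 1) (sphere_weight n (n - 1)) s (Phi r s) \<mu>"
      unfolding \<mu>_def using assms by (intro Phi_reproducing)
    show "sphere_weight n (n - 1) d > 0" if "d \<le> n - 1" for d
      using that by (simp add: sphere_weight_def)
  qed (use f assms in auto)
  then have "smult (1 / \<beta>) (smult \<beta> (Phi r s)) = smult (1 / \<beta>) (smult \<mu> ?f)" by simp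
  then have "Phi r s = smult (\<mu> / \<beta>) ?f" using \<open>\<beta> \<noteq> 0\<close> by simp
  then show ?thesis using \<open>\<beta> \<noteq> 0\<close> \<open>\<mu> \<noteq> 0\<close> unfolding L_def by (intro exI[of _ "\<mu> / \<beta>"]) simp
qed

theorem theorem1p4:
  fixes r s n :: nat
  assumes "r > 0" and "s > 0" and "n = r + s"
    and "\<exists>C. tight_symmetric_code n s C"
  shows "\<exists>Z :: int set. finite Z \<and> card Z = s
           \<and> proots (map_poly of_rat (Phi r s) :: complex poly) = mset_set (of_int ` Z)
           \<and> Z \<subseteq> {1 .. int r + int s - 1}"
proof -
  obtain C where C: "tight_symmetric_code n s C" using assms(4) by blast
  define S where "S = degree_set n C"
  have S: "S \<subseteq> {1..<n}" "card S = s"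
    using C degree_set_symmetric_code[of n C]
    by (auto simp: S_def tight_symmetric_code_def code_degree_def)
  have "finite S" using S(1) by (rule finite_subset) simp
  obtain c where c: "c \<noteq> 0" "Phi r s = smult c (\<Prod>a\<in>S. [:- of_nat a, 1:])"
    using Phi_eq_smult_annihilator[OF assms(1-3) C] by (auto simp: S_def)
  have "map_poly of_rat (Phi r s) = smult (of_rat c) (\<Prod>a\<in>S. [:- of_nat a, 1 :: complex:])"
    unfolding c(2) by (simp add: map_poly_smult of_rat_mult map_poly_of_rat_prod map_poly_pCons of_rat_minus)
  then have "proots (map_poly of_rat (Phi r s) :: complex poly) = mset_set (of_nat ` S)"
    using c(1) \<open>finite S\<close> by (simp add: proots_prod_linear inj_on_def)
  also have "of_nat ` S = (of_int ` int ` S :: complex set)" by (simp add: image_image)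
  finally show ?thesis
    using S \<open>finite S\<close> assms(3)
    by (intro exI[of _ "int ` S"]) (auto simp: card_image)
qed

end
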